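(* Let $k\ge 3$, $n=2^k$, and let $G_k$ be the ring graph on nodes $\{1,\dots,n\}$. For every $\lambda\in\left[\frac{8}{n^2},\frac12\right]$, the optimal value of the LambdaPrime LP relaxation of $G_k$ with parameter $\lambda$ equals $$\min_{t\in\mathbb{N}}\ \frac{n}{t}\left(1+\lambda\binom{t}{2}\right).$$
   Context: The ring graph $G_k$ has node set $\{1,\dots,n\}$ and edges $\{i,i+1\}$ for $i=1,\dots,n-1$ together with $\{1,n\}$. $\mathbb{N}=\{1,2,3,\dots\}$. The LambdaPrime LP relaxation of a graph $G=(V,E)$ with parameter $\lambda$ has variables $x_{ij}$ for unordered pairs $i<j$ of nodes and is: minimize $\sum_{(i,j)\in E}x_{ij}+\sum_{i<j}\lambda(1-x_{ij})$ subject to $x_{ij}\le x_{ik}+x_{jk}$ for all $i,j,k$ and $0\le x_{ij}\le 1$. *)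

theory Defs
  imports Complex_Main
begin

definition unordered_pairs :: "'a set \<Rightarrow> 'a set set" where
  "unordered_pairs V = {{i, j} | i j. i \<in> V \<and> j \<in> V \<and> i \<noteq> j}"

(* The LP variable of the unordered pair {i, j} is x {i, j}; the values of x on sets that are
   not two-element subsets of V play no role. For the same reason the triangle inequalities
   range over distinct nodes; the degenerate ones (with x_ii = 0) would follow from x >= 0. *)
definition lambda_prime_feasible :: "'a set \<Rightarrow> ('a set \<Rightarrow> real) \<Rightarrow> bool" where
  "lambda_prime_feasible V x \<longleftrightarrow>
     (\<forall>i\<in>V. \<forall>j\<in>V. \<forall>k\<in>V. i \<noteq> j \<longrightarrow> i \<noteq> k \<longrightarrow> j \<noteq> k \<longrightarrow> x {i, j} \<le> x {i, k} + x {j, k}) \<and>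
     (\<forall>e\<in>unordered_pairs V. 0 \<le> x e \<and> x e \<le> 1)"

definition lambda_prime_objective ::
  "'a set \<Rightarrow> 'a set set \<Rightarrow> real \<Rightarrow> ('a set \<Rightarrow> real) \<Rightarrow> real" where
  "lambda_prime_objective V E lam x =
     (\<Sum>e\<in>E. x e) + (\<Sum>e\<in>unordered_pairs V. lam * (1 - x e))"

(* A relation rather than an infimum: the optimal value has to be attained. *)
definition lambda_prime_optimal_value ::
  "'a set \<Rightarrow> 'a set set \<Rightarrow> real \<Rightarrow> real \<Rightarrow> bool" where
  "lambda_prime_optimal_value V E lam v \<longleftrightarrow>
     (\<exists>x. is_arg_min (lambda_prime_objective V E lam) (lambda_prime_feasible V) x \<and>
          lambda_prime_objective V E lam x = v)"

definition ring_nodes :: "nat \<Rightarrow> nat set" where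
  "ring_nodes n = {1..n}"

definition ring_edges :: "nat \<Rightarrow> nat set set" where
  "ring_edges n = insert {1, n} ((\<lambda>i. {i, i + 1}) ` {1..n - 1})"

end

theory Submission imports Defs begin

text \<open>
  Let \<open>n = 2 m\<close>, let \<open>S\<close> be the total weight of the ring edges in a feasible \<open>x\<close>, and let \<open>t\<close> be
  least with \<open>\<lambda> t (t + 1) / 2 \<ge> 1\<close>. Bounding each \<open>x\<^sub>i\<^sub>j\<close> at ring distance \<open>d\<close> by the weight of the
  short arc from \<open>i\<close> to \<open>j\<close> and summing over the rotations shows that the terms \<open>1 - x\<^sub>i\<^sub>j\<close> at
  distance \<open>d\<close> sum to at least \<open>n - d S\<close>. Using this bound with weight \<open>1\<close> for \<open>d < t\<close>, weight
  \<open>\<theta>\<close> for \<open>d = t\<close> and weight \<open>0\<close> beyond makes \<open>S\<close> cancel from the objective for a suitable \<open>\<theta>\<close>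
  (a dual solution), and leaves exactly the cost at \<open>t\<close>. The ring metric divided by \<open>t\<close> and
  truncated at \<open>1\<close> attains it. The hypothesis \<open>\<lambda> \<ge> 8 / n\<^sup>2\<close> gives \<open>t \<le> m\<close> and makes \<open>\<theta>\<close> admissible
  when \<open>t = m\<close>.
\<close>

section \<open>Rotations of the ring and sums over chords of a fixed length\<close>

definition ring_node :: "nat \<Rightarrow> nat \<Rightarrow> nat" where
  "ring_node n i = Suc (i mod n)"

text \<open>Indexing chords by starting point and offset turns a rotation of the ring into a shift
  of the summation index.\<close>

definition chord_sum :: "nat \<Rightarrow> (nat set \<Rightarrow> real) \<Rightarrow> nat \<Rightarrow> real" where
  "chord_sum n F d = (\<Sum>i<n. F {ring_node n i, ring_node n (i + d)})"

lemma ring_node_add_period [simp]: "ring_node n (i + n) = ring_node n i"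
  by (simp add: ring_node_def)

lemma ring_node_mem: "n > 0 \<Longrightarrow> ring_node n i \<in> {1..n}"
  by (simp add: ring_node_def Suc_le_eq)

lemma ring_node_less: "i < n \<Longrightarrow> ring_node n i = Suc i"
  by (simp add: ring_node_def)

lemma ring_node_add_neq:
  assumes "0 < d" "d < n"
  shows "ring_node n i \<noteq> ring_node n (i + d)"
proof
  assume "ring_node n i = ring_node n (i + d)"
  then have "(i + d) mod n = (i + 0) mod n"
    by (simp add: ring_node_def)
  then have "n dvd d"
    by (metis add.right_neutral mod_eq_dvd_iff_nat add_diff_cancel_left' le_add1)
  with assms show False
    by (simp add: nat_dvd_not_less)
qed

text \<open>Moving the window by one drops \<open>g l\<close> and gains \<open>g (l + n)\<close>,
  which is the same value.\<close>

lemma periodic_sum_shift: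
  fixes g :: "nat \<Rightarrow> real"
  assumes "\<And>i. g (i + n) = g i"
  shows "(\<Sum>i<n. g (i + l)) = (\<Sum>i<n. g i)"
proof (induction l)
  case (Suc l)
  have "(\<Sum>i<n. g (i + Suc l)) + g l = (\<Sum>i<Suc n. g (i + l))"
    by (subst sum.lessThan_Suc_shift) simp
  also have "\<dots> = (\<Sum>i<n. g (i + l)) + g l"
    using assms[of l] by (simp add: add.commute)
  finally show ?case
    using Suc by simp
qed simp

text \<open>The chord of length \<open>d\<close> that starts at \<open>i + (n - d)\<close> ends at
  \<open>i + n\<close>, that is, at \<open>i\<close>. It is the chord of length \<open>n - d\<close>
  from \<open>i\<close> traversed backwards.\<close>

lemma chord_sum_sym:
  assumes "d \<le> n"
  shows "chord_sum n F (n - d) = chord_sum n F d"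
proof -
  define g where "g i = F {ring_node n i, ring_node n (i + d)}" for i
  have per: "g (i + n) = g i" for i
    using ring_node_add_period[of n "i + d"] by (simp add: g_def algebra_simps)
  have "g (i + (n - d)) = F {ring_node n i, ring_node n (i + (n - d))}" for i
  proof -
    have "i + (n - d) + d = i + n"
      using assms by simp
    then show ?thesis
      unfolding g_def by (simp only: ring_node_add_period insert_commute)
  qed
  then have "chord_sum n F (n - d) = (\<Sum>i<n. g (i + (n - d)))"
    by (simp add: chord_sum_def)
  also have "\<dots> = (\<Sum>i<n. g i)"
    using per by (rule periodic_sum_shift)
  finally show ?thesis
    by (simp add: chord_sum_def g_def)
qed

section \<open>Sums over pairs and over ring edges, expressed by chord lengths\<close>

lemma sum_unordered_pairs_ordered:
  fixes F :: "nat set \<Rightarrow> real"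
  shows "sum F (unordered_pairs {1..n}) = (\<Sum>(i, j)\<in>{(i, j). i < j \<and> j < n}. F {Suc i, Suc j})"
proof -
  have "bij_betw (\<lambda>(i, j). {Suc i, Suc j}) {(i, j). i < j \<and> j < n} (unordered_pairs {1..n})"
    unfolding bij_betw_def
  proof
    show "inj_on (\<lambda>(i, j). {Suc i, Suc j}) {(i, j). i < j \<and> j < n}"
      by (auto simp: inj_on_def doubleton_eq_iff)
    show "(\<lambda>(i, j). {Suc i, Suc j}) ` {(i, j). i < j \<and> j < n} = unordered_pairs {1..n}"
    proof (intro set_eqI iffI)
      fix e assume "e \<in> (\<lambda>(i, j). {Suc i, Suc j}) ` {(i, j). i < j \<and> j < n}"
      then obtain i j where "e = {Suc i, Suc j}" "i < j" "j < n" by auto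
      then show "e \<in> unordered_pairs {1..n}"
        unfolding unordered_pairs_def by (intro CollectI exI[of _ "Suc i"] exI[of _ "Suc j"]) auto
    next
      fix e assume "e \<in> unordered_pairs {1..n}"
      then obtain a b where e: "e = {a, b}" "a \<in> {1..n}" "b \<in> {1..n}" "a \<noteq> b"
        unfolding unordered_pairs_def by auto
      show "e \<in> (\<lambda>(i, j). {Suc i, Suc j}) ` {(i, j). i < j \<and> j < n}"
      proof (cases "a < b")
        case True
        with e show ?thesis by (intro image_eqI[of _ _ "(a - 1, b - 1)"]) auto
      next
        case False
        with e show ?thesis by (intro image_eqI[of _ _ "(b - 1, a - 1)"]) auto
      qed
    qed
  qed
  from sum.reindex_bij_betw[OF this, of F] show ?thesis
    by (simp add: case_prod_unfold)
qed

text \<open>Each pair is a chord from either of its ends, once without and once with passing node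
  \<open>n\<close>. Splitting by this wrap-around gives two copies of the sum over pairs.\<close>

lemma sum_chord_sum:
  assumes "n > 0"
  shows "(\<Sum>d\<in>{1..<n}. chord_sum n F d) = 2 * sum F (unordered_pairs {1..n})"
proof -
  let ?D = "{(i, d). i < n \<and> 1 \<le> d \<and> d < n}"
  let ?h = "\<lambda>(i, d). F {ring_node n i, ring_node n (i + d)}"
  let ?T = "{(i, j). i < j \<and> j < n}"
  let ?f = "\<lambda>(i, j). F {Suc i, Suc j}"
  have fin: "finite ?D"
    by (rule finite_subset[of _ "{..<n} \<times> {..<n}"]) auto
  have "(\<Sum>d\<in>{1..<n}. chord_sum n F d) = (\<Sum>i<n. \<Sum>d\<in>{1..<n}. ?h (i, d))"
    unfolding chord_sum_def by (subst sum.swap) simp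
  also have "\<dots> = sum ?h ({..<n} \<times> {1..<n})"
    by (simp add: sum.cartesian_product)
  also have "{..<n} \<times> {1..<n} = ?D"
    by auto
  also have "sum ?h ?D = sum ?h {p\<in>?D. fst p + snd p < n} + sum ?h {p\<in>?D. \<not> fst p + snd p < n}"
    using fin by (subst sum.union_disjoint[symmetric]) (auto intro!: sum.cong)
  also have "sum ?h {p\<in>?D. fst p + snd p < n} = sum ?f ?T"
    by (rule sum.reindex_bij_witness[of _ "\<lambda>(i, j). (i, j - i)" "\<lambda>(i, d). (i, i + d)"])
       (auto simp: ring_node_less)
  also have "sum ?h {p\<in>?D. \<not> fst p + snd p < n} = sum ?f ?T"
  \<comment> \<open>A wrapping chord from \<open>i\<close> ends at index \<open>i + d - n\<close>,
    which is below \<open>i\<close> since \<open>d < n\<close>; hence the order of the two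
    components.\<close>
  proof (rule sum.reindex_bij_witness[of _ "\<lambda>(i, j). (j, i + n - j)" "\<lambda>(i, d). (i + d - n, i)"])
    fix p assume p: "p \<in> {p\<in>?D. \<not> fst p + snd p < n}"
    obtain i d where [simp]: "p = (i, d)" by fastforce
    have "ring_node n (i + d) = Suc (i + d - n)"
      using p ring_node_add_period[of n "i + d - n"] ring_node_less[of "i + d - n" n] by auto
    with p show "(case case p of (i, d) \<Rightarrow> (i + d - n, i) of (i, j) \<Rightarrow> F {Suc i, Suc j}) = ?h p"
      by (simp add: ring_node_less insert_commute)
  qed auto
  also have "sum ?f ?T = sum F (unordered_pairs {1..n})"
    by (rule sum_unordered_pairs_ordered[symmetric])
  finally show ?thesis
    by simp
qed

text \<open>The reflection of \<open>d\<close> to \<open>2 * m - d\<close> folds the long chords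
  onto the short ones. It fixes only \<open>m\<close>, whose term therefore keeps the factor
  \<open>1 / 2\<close>.\<close>

lemma sum_unordered_pairs_chord_sum:
  assumes "m > 0"
  shows "sum F (unordered_pairs {1..2 * m}) =
    (\<Sum>d\<in>{1..<m}. chord_sum (2 * m) F d) + chord_sum (2 * m) F m / 2"
proof -
  let ?A = "chord_sum (2 * m) F"
  have "(\<Sum>d\<in>{1..<2 * m}. ?A d) = (\<Sum>d\<in>{1..<m}. ?A d) + (\<Sum>d\<in>{m..<2 * m}. ?A d)"
    using assms by (subst sum.atLeastLessThan_concat) auto
  also have "(\<Sum>d\<in>{m..<2 * m}. ?A d) = ?A m + (\<Sum>d\<in>{Suc m..<2 * m}. ?A d)"
    using assms by (subst sum.atLeast_Suc_lessThan) auto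
  also have "(\<Sum>d\<in>{Suc m..<2 * m}. ?A d) = (\<Sum>d\<in>{1..<m}. ?A d)"
    by (rule sum.reindex_bij_witness[of _ "\<lambda>d. 2 * m - d" "\<lambda>d. 2 * m - d"])
       (auto simp: chord_sum_sym)
  finally show ?thesis
    using sum_chord_sum[of "2 * m" F] assms by simp
qed

text \<open>From \<open>n \<ge> 3\<close> on, the closing edge \<open>{1, n}\<close> differs from
  all edges \<open>{i, i + 1}\<close>; it is the chord of length 1 from index
  \<open>n - 1\<close>.\<close>

lemma sum_ring_edges:
  assumes "n \<ge> 3"
  shows "sum F (ring_edges n) = chord_sum n F 1"
proof -
  have inj: "inj_on (\<lambda>i. {i, i + 1}) {1..n - 1}"
    by (auto simp: inj_on_def doubleton_eq_iff)
  have notin: "{1, n} \<notin> (\<lambda>i. {i, i + 1}) ` {1..n - 1}"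
  proof (rule notI, elim imageE)
    fix i assume "{1, n} = {i, i + 1}" "i \<in> {1..n - 1}"
    then have "n = 2"
      unfolding doubleton_eq_iff atLeastAtMost_iff by linarith
    with assms show False
      by simp
  qed
  have "sum F (ring_edges n) = F {1, n} + (\<Sum>i\<in>{1..n - 1}. F {i, i + 1})"
    unfolding ring_edges_def using notin inj by (simp add: sum.reindex)
  also have "(\<Sum>i\<in>{1..n - 1}. F {i, i + 1}) = (\<Sum>i<n - 1. F {ring_node n i, ring_node n (i + 1)})"
    by (rule sum.reindex_bij_witness[of _ Suc "\<lambda>i. i - 1"]) (auto simp: ring_node_less)
  also have "F {1, n} = F {ring_node n (n - 1), ring_node n (n - 1 + 1)}"
    using assms by (simp add: ring_node_def insert_commute)
  also have "\<dots> + (\<Sum>i<n - 1. F {ring_node n i, ring_node n (i + 1)}) = chord_sum n F 1"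
    unfolding chord_sum_def
    using assms sum.lessThan_Suc[of "\<lambda>i. F {ring_node n i, ring_node n (i + 1)}" "n - 1"] by simp
  finally show ?thesis .
qed

section \<open>Lower bound for every feasible point\<close>

lemma feasible_bounds:
  assumes "lambda_prime_feasible V x" "i \<in> V" "j \<in> V" "i \<noteq> j"
  shows "0 \<le> x {i, j}" "x {i, j} \<le> 1"
  using assms unfolding lambda_prime_feasible_def unordered_pairs_def by blast+

lemma feasible_path_bound:
  assumes feas: "lambda_prime_feasible {1..n} x" and "0 < d" "d < n"
  shows "x {ring_node n i, ring_node n (i + d)} \<le>
    (\<Sum>l<d. x {ring_node n (i + l), ring_node n (i + l + 1)})"
  using assms(2,3)
proof (induction d)
  case (Suc d)
  show ?case
  \<comment> \<open>Triangle inequalities are available for distinct nodes only, so the arc of a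
    single edge is separate.\<close>
  proof (cases "d = 0")
    case False
    have "ring_node n i \<noteq> ring_node n (i + Suc d)" "ring_node n i \<noteq> ring_node n (i + d)"
      "ring_node n (i + Suc d) \<noteq> ring_node n (i + d)"
      using Suc.prems False ring_node_add_neq[of "Suc d" n i] ring_node_add_neq[of d n i]
        ring_node_add_neq[of 1 n "i + d"] by auto
    moreover have "ring_node n j \<in> {1..n}" for j
      using Suc.prems by (intro ring_node_mem) simp
    ultimately have "x {ring_node n i, ring_node n (i + Suc d)} \<le>
        x {ring_node n i, ring_node n (i + d)} + x {ring_node n (i + Suc d), ring_node n (i + d)}"
      using feas unfolding lambda_prime_feasible_def by blast
    then show ?thesis
      using Suc False by (simp add: insert_commute)
  qed simp
qed simp

text \<open>Over all rotations, arcs of length \<open>d\<close> cover every ring edge exactly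
  \<open>d\<close> times.\<close>

lemma feasible_chord_sum_bounds:
  assumes feas: "lambda_prime_feasible {1..n} x" and d: "0 < d" "d < n"
  shows "0 \<le> chord_sum n (\<lambda>e. 1 - x e) d"
    and "real n - real d * chord_sum n x 1 \<le> chord_sum n (\<lambda>e. 1 - x e) d"
proof -
  have "ring_node n j \<in> {1..n}" for j
    using d by (intro ring_node_mem) simp
  then show "0 \<le> chord_sum n (\<lambda>e. 1 - x e) d"
    unfolding chord_sum_def using feasible_bounds[OF feas] ring_node_add_neq[OF d]
    by (intro sum_nonneg) simp
  define g where "g i = x {ring_node n i, ring_node n (i + 1)}" for i
  have per: "g (i + n) = g i" for i
    using ring_node_add_period[of n "i + 1"] by (simp add: g_def algebra_simps)
  have "chord_sum n x d \<le> (\<Sum>i<n. \<Sum>l<d. g (i + l))"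
    unfolding chord_sum_def g_def by (intro sum_mono feasible_path_bound[OF feas d])
  also have "\<dots> = (\<Sum>l<d. \<Sum>i<n. g (i + l))"
    by (rule sum.swap)
  also have "\<dots> = real d * chord_sum n x 1"
    using periodic_sum_shift[of g n] per by (simp add: chord_sum_def g_def)
  finally show "real n - real d * chord_sum n x 1 \<le> chord_sum n (\<lambda>e. 1 - x e) d"
    by (simp add: chord_sum_def sum_subtractf)
qed

lemma sum_of_nat_atLeastLessThan:
  "(\<Sum>d\<in>{1..<t}. real d) = real t * (real t - 1) / 2"
proof (induction t)
  case (Suc t)
  then show ?case
    by (cases "t = 0") (auto simp: field_simps sum.atLeastLessThan_Suc)
qed simp

lemma real_choose_two: "real (t choose 2) = real t * (real t - 1) / 2"
  by (induction t) (auto simp: numeral_2_eq_2 field_simps)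

text \<open>The three bounds on \<open>lam\<close> make the dual weight admissible:
  \<open>lo\<close> gives \<open>0 \<le> \<theta>\<close>, \<open>hi\<close> gives
  \<open>\<theta> \<le> 1\<close> for \<open>t < m\<close>, and \<open>hi'\<close> gives
  \<open>\<theta> \<le> 1 / 2\<close> for \<open>t = m\<close>.\<close>

lemma ring_objective_lower_bound:
  assumes feas: "lambda_prime_feasible {1..2 * m} x" and m: "m \<ge> 2"
    and t: "1 \<le> t" "t \<le> m" and lam: "lam > 0"
    and lo: "lam * (real t * (real t - 1)) \<le> 2"
    and hi: "2 \<le> lam * (real t * (real t + 1))"
    and hi': "2 \<le> lam * (real m)\<^sup>2"
  shows "2 * real m * (1 / real t + lam * (real t - 1) / 2)
    \<le> lambda_prime_objective {1..2 * m} (ring_edges (2 * m)) lam x"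
proof -
  let ?A = "chord_sum (2 * m) (\<lambda>e. 1 - x e)"
  define S where "S = chord_sum (2 * m) x 1"
  define P where "P = (\<Sum>e\<in>unordered_pairs {1..2 * m}. 1 - x e)"
  \<comment> \<open>The rotations of a diameter visit every antipodal pair twice, so only half of the sum at
    distance \<open>m\<close> is available.\<close>
  define c where "c = (if t < m then 1 else 1 / 2 :: real)"
  \<comment> \<open>Solves \<open>lam * (t (t - 1) / 2 + \<theta> t) = 1\<close>, which cancels \<open>S\<close>.\<close>
  define \<theta> where "\<theta> = (1 / lam - real t * (real t - 1) / 2) / real t"
  have P: "P = (\<Sum>d\<in>{1..<m}. ?A d) + ?A m / 2"
    unfolding P_def by (rule sum_unordered_pairs_chord_sum) (use m in simp)
  have A0: "0 \<le> ?A d" and AS: "2 * real m - real d * S \<le> ?A d" if "1 \<le> d" "d \<le> m" for d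
    using feasible_chord_sum_bounds[OF feas, of d] that m by (auto simp: S_def)
  have \<theta>0: "0 \<le> \<theta>"
    using lo lam t by (auto simp: \<theta>_def field_simps)
  have \<theta>c: "\<theta> \<le> c"
    using hi hi' lam t by (auto simp: \<theta>_def c_def field_simps power2_eq_square)
  have "(\<Sum>d\<in>{1..<t}. ?A d) + c * ?A t \<le> P"
  proof (cases "t < m")
    case True
    have "(\<Sum>d\<in>{1..<Suc t}. ?A d) \<le> (\<Sum>d\<in>{1..<m}. ?A d)"
      using True A0 by (intro sum_mono2) auto
    then show ?thesis
      using True A0[of m] m t by (simp add: P c_def)
  next
    case False
    then show ?thesis
      using t by (simp add: P c_def)
  qed
  moreover have "(\<Sum>d\<in>{1..<t}. 2 * real m - real d * S) \<le> (\<Sum>d\<in>{1..<t}. ?A d)"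
    using t by (intro sum_mono AS) auto
  moreover have "\<theta> * (2 * real m - real t * S) \<le> c * ?A t"
  proof -
    have "\<theta> * (2 * real m - real t * S) \<le> \<theta> * ?A t"
      using AS[of t] t \<theta>0 by (intro mult_left_mono) auto
    also have "\<dots> \<le> c * ?A t"
      using \<theta>c A0[of t] t by (intro mult_right_mono) auto
    finally show ?thesis .
  qed
  moreover have "(\<Sum>d\<in>{1..<t}. 2 * real m - real d * S)
      = 2 * real m * (real t - 1) - real t * (real t - 1) / 2 * S"
    using t by (simp add: sum_subtractf sum_distrib_right[symmetric]
        sum_of_nat_atLeastLessThan[simplified] of_nat_diff)
  ultimately have "2 * real m * (real t - 1) - real t * (real t - 1) / 2 * S
      + \<theta> * (2 * real m - real t * S) \<le> P"
    by linarith
  then have "lam * (2 * real m * (real t - 1) - real t * (real t - 1) / 2 * S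
      + \<theta> * (2 * real m - real t * S)) \<le> lam * P"
    using lam by (intro mult_left_mono) auto
  moreover have "S + lam * (2 * real m * (real t - 1) - real t * (real t - 1) / 2 * S
      + \<theta> * (2 * real m - real t * S)) = 2 * real m * (1 / real t + lam * (real t - 1) / 2)"
    using lam t by (simp add: \<theta>_def field_simps)
  moreover have "lambda_prime_objective {1..2 * m} (ring_edges (2 * m)) lam x = S + lam * P"
    unfolding lambda_prime_objective_def P_def S_def
    using m by (simp add: sum_ring_edges sum_distrib_left)
  ultimately show ?thesis
    by linarith
qed

section \<open>The truncated ring metric and its objective value\<close>

text \<open>\<open>Max\<close> and \<open>Min\<close> recover the endpoints, since LP variables are
  indexed by sets.\<close>

definition ring_dist :: "nat \<Rightarrow> nat set \<Rightarrow> nat" where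
  "ring_dist n e = min (Max e - Min e) (n - (Max e - Min e))"

definition truncated_ring_metric :: "nat \<Rightarrow> nat \<Rightarrow> nat set \<Rightarrow> real" where
  "truncated_ring_metric n t e = min 1 (real (ring_dist n e) / real t)"

lemma ring_dist_doubleton:
  "ring_dist n {i, j} = (if i \<le> j then min (j - i) (n - (j - i)) else min (i - j) (n - (i - j)))"
  by (auto simp: ring_dist_def min_def max_def)

lemma ring_dist_triangle:
  assumes "i \<in> {1..n}" "j \<in> {1..n}" "k \<in> {1..n}"
  shows "ring_dist n {i, j} \<le> ring_dist n {i, k} + ring_dist n {j, k}"
proof -
  \<comment> \<open>Over the integers the truncated subtractions disappear and linear arithmetic can
    decide the cases.\<close>
  have int_ring_dist: "int (ring_dist n {a, b}) = min \<bar>int a - int b\<bar> (int n - \<bar>int a - int b\<bar>)"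
    if "a \<in> {1..n}" "b \<in> {1..n}" for a b
    using that by (auto simp: ring_dist_doubleton of_nat_diff min_def)
  have "int (ring_dist n {i, j}) \<le> int (ring_dist n {i, k}) + int (ring_dist n {j, k})"
    using assms unfolding int_ring_dist[OF assms(1,2)] int_ring_dist[OF assms(1,3)]
      int_ring_dist[OF assms(2,3)] atLeastAtMost_iff
    by linarith
  then show ?thesis
    by linarith
qed

lemma truncated_ring_metric_feasible:
  assumes "t \<ge> 1"
  shows "lambda_prime_feasible {1..n} (truncated_ring_metric n t)"
  unfolding lambda_prime_feasible_def
proof (intro conjI ballI impI)
  fix i j k assume "i \<in> {1..n}" "j \<in> {1..n}" "k \<in> {1..n}"
  then have "real (ring_dist n {i, j}) \<le> real (ring_dist n {i, k}) + real (ring_dist n {j, k})"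
    using ring_dist_triangle[of i n j k] by linarith
  then have "real (ring_dist n {i, j}) / real t
      \<le> real (ring_dist n {i, k}) / real t + real (ring_dist n {j, k}) / real t"
    by (simp add: add_divide_distrib[symmetric] divide_right_mono)
  \<comment> \<open>If one summand on the right is truncated to 1, the bound needs the other to be
    nonnegative.\<close>
  moreover have "0 \<le> real (ring_dist n {i, k}) / real t" "0 \<le> real (ring_dist n {j, k}) / real t"
    by simp_all
  ultimately show "truncated_ring_metric n t {i, j}
      \<le> truncated_ring_metric n t {i, k} + truncated_ring_metric n t {j, k}"
    unfolding truncated_ring_metric_def by linarith
qed (simp_all add: truncated_ring_metric_def)

lemma ring_dist_ring_node:
  assumes "d \<le> m" "m > 0"
  shows "ring_dist (2 * m) {ring_node (2 * m) i, ring_node (2 * m) (i + d)} = d"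
proof -
  define r where "r = i mod (2 * m)"
  have r: "r < 2 * m"
    using assms by (simp add: r_def)
  have "(i + d) mod (2 * m) = (r + d) mod (2 * m)"
    by (simp add: r_def mod_add_left_eq)
  also have "\<dots> = (if r + d < 2 * m then r + d else r + d - 2 * m)"
    using r assms by (simp add: mod_if)
  finally show ?thesis
    using r assms unfolding ring_node_def r_def[symmetric]
    by (auto simp: ring_dist_doubleton min_def)
qed

lemma chord_sum_truncated_ring_metric:
  assumes "d \<le> m" "m > 0"
  shows "chord_sum (2 * m) (truncated_ring_metric (2 * m) t) d = 2 * real m * min 1 (real d / real t)"
    and "chord_sum (2 * m) (\<lambda>e. 1 - truncated_ring_metric (2 * m) t e) d
      = 2 * real m * (1 - min 1 (real d / real t))"
  using ring_dist_ring_node[OF assms] by (simp_all add: chord_sum_def truncated_ring_metric_def)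

lemma truncated_ring_metric_objective:
  assumes "m \<ge> 2" "1 \<le> t" "t \<le> m"
  shows "lambda_prime_objective {1..2 * m} (ring_edges (2 * m)) lam (truncated_ring_metric (2 * m) t)
    = 2 * real m * (1 / real t + lam * (real t - 1) / 2)"
proof -
  let ?x = "truncated_ring_metric (2 * m) t"
  let ?A = "chord_sum (2 * m) (\<lambda>e. 1 - ?x e)"
  have "sum ?x (ring_edges (2 * m)) = 2 * real m * (1 / real t)"
    using assms sum_ring_edges[of "2 * m" ?x] chord_sum_truncated_ring_metric(1)[of 1 m t]
    by simp
  moreover have "(\<Sum>e\<in>unordered_pairs {1..2 * m}. 1 - ?x e) = 2 * real m * ((real t - 1) / 2)"
  proof -
    \<comment> \<open>As \<open>t \<le> m\<close>, this covers the antipodal length \<open>m\<close>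
      too, so its halved term vanishes.\<close>
    have zero: "?A d = 0" if "t \<le> d" "d \<le> m" for d
      using assms that by (simp add: chord_sum_truncated_ring_metric)
    have "(\<Sum>d\<in>{1..<m}. ?A d) = (\<Sum>d\<in>{1..<t}. ?A d)"
      using assms zero by (intro sum.mono_neutral_right) auto
    also have "\<dots> = (\<Sum>d\<in>{1..<t}. 2 * real m * (1 - real d / real t))"
      using assms by (intro sum.cong) (auto simp: chord_sum_truncated_ring_metric)
    also have "\<dots> = 2 * real m * ((real t - 1) - (\<Sum>d\<in>{1..<t}. real d) / real t)"
      using assms by (simp add: sum_distrib_left[symmetric] sum_subtractf
          sum_divide_distrib[symmetric] of_nat_diff)
    also have "\<dots> = 2 * real m * ((real t - 1) / 2)"
      unfolding sum_of_nat_atLeastLessThan using assms by (simp add: field_simps)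
    finally show ?thesis
      using assms zero[of m] sum_unordered_pairs_chord_sum[of m "\<lambda>e. 1 - ?x e"] by simp
  qed
  ultimately show ?thesis
    unfolding lambda_prime_objective_def sum_distrib_left[symmetric]
    by (simp only: distrib_left mult.left_commute times_divide_eq_right)
qed

section \<open>The optimal cluster size and the conclusion\<close>

text \<open>The cost at \<open>s\<close> minus the cost at \<open>t\<close> is
  \<open>(s - t) * (lam * s * t - 2) / (2 * s * t)\<close>. By integrality
  \<open>s \<le> t - 1\<close> or \<open>s \<ge> t + 1\<close> when they differ, so
  \<open>lo\<close> and \<open>hi\<close> give both factors the same sign.\<close>

lemma cluster_cost_minimal:
  fixes lam :: real and s t :: nat
  assumes "1 \<le> s" "1 \<le> t"
    and lo: "lam * (real t * (real t - 1)) \<le> 2"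
    and hi: "2 \<le> lam * (real t * (real t + 1))" and lam: "lam > 0"
  shows "1 / real t + lam * (real t - 1) / 2 \<le> 1 / real s + lam * (real s - 1) / 2"
proof -
  have "0 \<le> (real s - real t) * (lam * (real s * real t) - 2)"
  proof (cases s t rule: linorder_cases)
    case less
    then have "real s \<le> real t - 1"
      by linarith
    then have "lam * (real s * real t) \<le> lam * (real t * (real t - 1))"
      using lam assms by (simp add: mult.commute mult_left_mono)
    with lo less show ?thesis
      by (intro mult_nonpos_nonpos) auto
  next
    case greater
    then have "real t + 1 \<le> real s"
      by linarith
    then have "lam * (real t * (real t + 1)) \<le> lam * (real s * real t)"
      using lam assms by (simp add: mult.commute mult_left_mono)
    with hi greater show ?thesis
      by (intro mult_nonneg_nonneg) auto
  qed simp
  also have "\<dots> = 2 * (real s * real t) *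
      ((1 / real s + lam * (real s - 1) / 2) - (1 / real t + lam * (real t - 1) / 2))"
    using assms by (simp add: field_simps)
  finally have "0 \<le> (1 / real s + lam * (real s - 1) / 2) - (1 / real t + lam * (real t - 1) / 2)"
    using assms by (subst (asm) zero_le_mult_iff) (auto simp: mult_le_0_iff)
  then show ?thesis
    by simp
qed

theorem theorem5:
  fixes k n :: nat and lam :: real
  assumes "k \<ge> 3" and "n = 2 ^ k"
    and "lam \<in> {8 / (real n)\<^sup>2 .. 1 / 2}"
  shows "\<exists>t. is_arg_min (\<lambda>t::nat. real n / real t * (1 + lam * real (t choose 2))) (\<lambda>t. t \<ge> 1) t \<and>
             lambda_prime_optimal_value (ring_nodes n) (ring_edges n) lam
               (real n / real t * (1 + lam * real (t choose 2)))"
proof -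
  define m :: nat where "m = 2 ^ (k - 1)"
  have n: "n = 2 * m"
    using assms(1,2) by (simp add: m_def flip: power_Suc)
  have "(2::nat) ^ 1 \<le> m"
    unfolding m_def using assms(1) by (intro power_increasing) auto
  then have m: "m \<ge> 2"
    by simp
  \<comment> \<open>With \<open>n = 2 * m\<close>, the lower end \<open>8 / n^2\<close> of the
    interval is \<open>2 / m^2\<close>.\<close>
  have lam_lo: "2 \<le> lam * (real m)\<^sup>2"
    using assms(3) m by (simp add: n field_simps power2_eq_square)
  have lam: "lam > 0"
    using lam_lo m by (smt (verit) mult_nonpos_nonneg zero_le_power2)
  \<comment> \<open>For positive \<open>t\<close>, \<open>Q t\<close> says that passing from
    \<open>t\<close> to \<open>t + 1\<close> does not lower the cost.\<close>
  define Q where "Q t \<longleftrightarrow> 1 \<le> t \<and> 2 \<le> lam * (real t * (real t + 1))" for t :: nat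
  have "lam * (real m)\<^sup>2 \<le> lam * (real m * (real m + 1))"
    using lam by (simp add: power2_eq_square algebra_simps)
  then have Qm: "Q m"
    using lam_lo m by (simp add: Q_def)
  define t where "t = (LEAST t. Q t)"
  have Qt: "Q t" and tm: "t \<le> m"
    unfolding t_def using Qm by (rule LeastI, rule Least_le)
  have t: "1 \<le> t" and hi: "2 \<le> lam * (real t * (real t + 1))"
    using Qt by (auto simp: Q_def)
  have lo: "lam * (real t * (real t - 1)) \<le> 2"
  proof (cases "t = 1")
    case False
    \<comment> \<open>With \<open>t - 1 \<ge> 1\<close>, failure of \<open>Q\<close> there means
      \<open>lam * ((t - 1) * t) < 2\<close>.\<close>
    have "\<not> Q (t - 1)"
      using not_less_Least[of "t - 1" Q] t by (simp add: t_def[symmetric])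
    then show ?thesis
      using False t by (auto simp: Q_def of_nat_diff mult.commute)
  qed simp
  have cost: "real n / real s * (1 + lam * real (s choose 2))
      = 2 * real m * (1 / real s + lam * (real s - 1) / 2)" if "1 \<le> s" for s
    using that by (simp add: n real_choose_two field_simps)
  have "is_arg_min (\<lambda>t::nat. real n / real t * (1 + lam * real (t choose 2))) (\<lambda>t. t \<ge> 1) t"
    unfolding is_arg_min_linorder
    using t cost cluster_cost_minimal[OF _ t lo hi lam] by (simp add: mult_left_mono)
  moreover have "lambda_prime_optimal_value (ring_nodes n) (ring_edges n) lam
      (real n / real t * (1 + lam * real (t choose 2)))"
    unfolding lambda_prime_optimal_value_def is_arg_min_linorder ring_nodes_def cost[OF t]
    unfolding n truncated_ring_metric_objective[OF m t tm, symmetric]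
    using truncated_ring_metric_feasible[OF t]
      ring_objective_lower_bound[OF _ m t tm lam lo hi lam_lo,
        folded truncated_ring_metric_objective[OF m t tm]]
    by blast
  ultimately show ?thesis
    by blast
qed

end
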